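(* Let $P$ be a pseudo-polygon and assign to every invisible pair of $P$ its designated blocker. Suppose two invisible pairs are a separable invisible pair with respect to a candidate blocker $p_k$. If $p_k$ is the blocker assigned to one of them, then it is not the blocker assigned to the other.
   Context: **Pseudo-polygons.** An arrangement of pseudo-lines is a collection of simple curves in $\mathbb{R}^2$, each of which separates the plane, such that each pair of them intersects at exactly one point, where they cross. Let $P=\{p_0,\dots,p_{n-1}\}$ ($n\ge 3$) be a set of points in $\mathbb{R}^2$ and $\mathcal{L}$ an arrangement of $\binom n2$ pseudo-lines such that every pair of points $p_i,p_j$ lies on exactly one pseudo-line of $\mathcal{L}$, denoted $L_{i,j}$, and every pseudo-line in $\mathcal{L}$ contains exactly two points of $P$; $(P,\mathcal{L})$ is a pseudo configuration of points in general position. The subsegment of $L_{i,j}$ connecting $p_i$ and $p_j$ is the segment $p_ip_j$; removing it leaves two rays, one starting at $p_i$ and moving away from $p_j$, the other starting at $p_j$ and moving away from $p_i$. Indices are modulo $n$. Let $e_i$ be the segment $p_ip_{i+1}$. The segments $e_0,\dots,e_{n-1}$ form a pseudo-polygon (with boundary edges $e_i$) if $e_i\cap e_{i+1}=\{p_{i+1}\}$ for all $i$ and non-consecutive $e_i,e_j$ are disjoint. Vertices are indexed in counterclockwise order along the boundary. The pseudo-polygon separates the plane into an inside and an outside; two vertices $p_i,p_j$ see each other if the segment $p_ip_j$ does not go outside the pseudo-polygon. **Combinatorial notions.** $\partial(p_i,p_j)$ denotes the vertices and boundary edges encountered when walking counterclockwise along the boundary from $p_i$ to $p_j$ (inclusive).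 Two vertices that see each other form a visible pair $\{p_i,p_j\}$ (unordered). If distinct $p_i,p_j$ do not see each other, both ordered pairs $(p_i,p_j)$ and $(p_j,p_i)$ are called invisible pairs. **Designated blocker.** Let $(p_i,p_j)$ be an invisible pair. A vertex $p_k\in\partial(p_i,p_j)$ is a designated blocker for $(p_i,p_j)$ if $p_i$ sees $p_k$ and the ray of $L_{i,k}$ starting at $p_k$ and moving away from $p_i$ first exits the pseudo-polygon through a boundary edge in $\partial(p_j,p_i)$. Similarly, $p_k\in\partial(p_j,p_i)$ is a designated blocker for $(p_i,p_j)$ if $p_i$ sees $p_k$ and the ray of $L_{i,k}$ starting at $p_k$ and moving away from $p_i$ first exits the pseudo-polygon through a boundary edge in $\partial(p_i,p_j)$. (Here $k\neq i,j$.) Every invisible pair in a pseudo-polygon has exactly one designated blocker, so the assignment is well defined. **Candidate blocker.** Let $(p_i,p_j)$ be an invisible pair. Let $p_k$ be the first vertex, walking clockwise from $p_j$ towards $p_i$, such that $\{p_i,p_k\}$ is a visible pair; $p_k$ is a candidate blocker for $(p_i,p_j)$ if there is no visible pair $\{p_s,p_t\}$ with $p_s\in\partial(p_i,p_{k-1})$ and $p_t\in\partial(p_{k+1},p_j)$. Similarly, let $p_{k'}$ be the first vertex, walking counterclockwise from $p_j$ towards $p_i$, such that $\{p_i,p_{k'}\}$ is a visible pair; $p_{k'}$ is a candidate blocker for $(p_i,p_j)$ if there is no visible pair $\{p_s,p_t\}$ with $p_s\in\partial(p_j,p_{k'-1})$ and $p_t\in\partial(p_{k'+1},p_i)$. There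 are no other candidate blockers. **Separable.** Suppose $p_k$ is a candidate blocker for an invisible pair $(p_i,p_j)$ or $(p_j,p_i)$, with names chosen so that $p_i\in\partial(p_j,p_k)$. If $p_k$ is also a candidate blocker for an invisible pair $(p_s,p_t)$ with $p_s,p_t\in\partial(p_k,p_j)$, then the two invisible pairs are a separable invisible pair (with respect to $p_k$). *)

theory Defs
  imports "HOL-Complex_Analysis.Complex_Analysis"
begin

text \<open>The plane is the type \<^typ>\<open>complex\<close>. Points are \<open>p 0, \<dots>, p (n - 1)\<close>; all indices below are
  natural numbers less than \<open>n\<close>, and arithmetic on them is modulo \<open>n\<close>.\<close>

section \<open>Pseudo-lines\<close>

text \<open>A simple curve is a homeomorphic copy of the real line. Together with separation of the plane
  this already forces \<open>l\<close> to be closed (both ends go to infinity): points of the curve have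
  arbitrarily thin two-sided neighbourhoods whose halves lie in different components, so a limit
  point off the curve would belong to both. Closedness is listed for convenience.\<close>

definition pseudo_line :: "complex set \<Rightarrow> bool" where
  "pseudo_line l \<longleftrightarrow>
     l homeomorphic (UNIV :: real set) \<and> closed l \<and> \<not> connected (- l)"

text \<open>\<open>m\<close> crosses \<open>l\<close> at \<open>x\<close> if, arbitrarily close to \<open>x\<close>, it visits two different sides of \<open>l\<close>.\<close>

definition crosses_at :: "complex set \<Rightarrow> complex set \<Rightarrow> complex \<Rightarrow> bool" where
  "crosses_at l m x \<longleftrightarrow> x \<in> l \<inter> m \<and>
     (\<forall>U. open U \<and> x \<in> U \<longrightarrow>
        (\<exists>y \<in> (m - l) \<inter> U. \<exists>z \<in> (m - l) \<inter> U. \<not> connected_component (- l) y z))"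

definition pseudo_line_arrangement :: "complex set set \<Rightarrow> bool" where
  "pseudo_line_arrangement LL \<longleftrightarrow>
     (\<forall>l \<in> LL. pseudo_line l) \<and>
     (\<forall>l \<in> LL. \<forall>m \<in> LL. l \<noteq> m \<longrightarrow> (\<exists>x. l \<inter> m = {x} \<and> crosses_at l m x))"

definition pseudo_configuration :: "nat \<Rightarrow> (nat \<Rightarrow> complex) \<Rightarrow> complex set set \<Rightarrow> bool" where
  "pseudo_configuration n p LL \<longleftrightarrow>
     n \<ge> 3 \<and> inj_on p {..<n} \<and>
     pseudo_line_arrangement LL \<and> card LL = n choose 2 \<and>
     (\<forall>i<n. \<forall>j<n. i \<noteq> j \<longrightarrow> (\<exists>!l. l \<in> LL \<and> p i \<in> l \<and> p j \<in> l)) \<and>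
     (\<forall>l \<in> LL. card (l \<inter> p ` {..<n}) = 2)"

definition line_through ::
    "(nat \<Rightarrow> complex) \<Rightarrow> complex set set \<Rightarrow> nat \<Rightarrow> nat \<Rightarrow> complex set" where
  "line_through p LL i j = (THE l. l \<in> LL \<and> p i \<in> l \<and> p j \<in> l)"

text \<open>The part of the pseudo-line \<open>l\<close> between its points \<open>a\<close> and \<open>b\<close>, endpoints included;
  the choice of the parametrization \<open>f\<close> (with inverse \<open>g\<close>) is immaterial.\<close>

definition subsegment :: "complex set \<Rightarrow> complex \<Rightarrow> complex \<Rightarrow> complex set" where
  "subsegment l a b =
     {x. \<exists>f g. homeomorphism (UNIV :: real set) l f g \<and> x \<in> f ` closed_segment (g a) (g b)}"

text \<open>The ray on \<open>l\<close> starting at \<open>a\<close> and moving away from \<open>b\<close>; the starting point \<open>a\<close> is included.\<close>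

definition ray_away :: "complex set \<Rightarrow> complex \<Rightarrow> complex \<Rightarrow> complex set" where
  "ray_away l a b = {x \<in> l. a \<in> subsegment l b x}"


section \<open>Pseudo-polygons\<close>

definition segm ::
    "(nat \<Rightarrow> complex) \<Rightarrow> complex set set \<Rightarrow> nat \<Rightarrow> nat \<Rightarrow> complex set" where
  "segm p LL i j = subsegment (line_through p LL i j) (p i) (p j)"

definition edge ::
    "nat \<Rightarrow> (nat \<Rightarrow> complex) \<Rightarrow> complex set set \<Rightarrow> nat \<Rightarrow> complex set" where
  "edge n p LL i = segm p LL i ((i + 1) mod n)"

definition bdry :: "nat \<Rightarrow> (nat \<Rightarrow> complex) \<Rightarrow> complex set set \<Rightarrow> complex set" where
  "bdry n p LL = (\<Union>i<n. edge n p LL i)"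

text \<open>Counterclockwise indexing: some parametrization of the boundary that traverses the edges in
  the order of their indices winds once positively around the inside.\<close>

definition ccw_indexed :: "nat \<Rightarrow> (nat \<Rightarrow> complex) \<Rightarrow> complex set set \<Rightarrow> bool" where
  "ccw_indexed n p LL \<longleftrightarrow>
     (\<exists>\<gamma>. simple_path \<gamma> \<and> pathfinish \<gamma> = pathstart \<gamma> \<and>
        (\<forall>i<n. \<gamma> (real i / real n) = p i \<and>
               \<gamma> ` {real i / real n .. real (i + 1) / real n} = edge n p LL i) \<and>
        (\<forall>z \<in> inside (bdry n p LL). winding_number \<gamma> z = 1))"

definition pseudo_polygon :: "nat \<Rightarrow> (nat \<Rightarrow> complex) \<Rightarrow> complex set set \<Rightarrow> bool" where
  "pseudo_polygon n p LL \<longleftrightarrow>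
     pseudo_configuration n p LL \<and>
     (\<forall>i<n. edge n p LL i \<inter> edge n p LL ((i + 1) mod n) = {p ((i + 1) mod n)}) \<and>
     (\<forall>i<n. \<forall>j<n. i \<noteq> j \<and> j \<noteq> (i + 1) mod n \<and> i \<noteq> (j + 1) mod n \<longrightarrow>
        edge n p LL i \<inter> edge n p LL j = {}) \<and>
     ccw_indexed n p LL"


section \<open>Visibility\<close>

definition visible_pair ::
    "nat \<Rightarrow> (nat \<Rightarrow> complex) \<Rightarrow> complex set set \<Rightarrow> nat \<Rightarrow> nat \<Rightarrow> bool" where
  "visible_pair n p LL i j \<longleftrightarrow>
     i < n \<and> j < n \<and> i \<noteq> j \<and> segm p LL i j \<inter> outside (bdry n p LL) = {}"

definition invisible_pair ::
    "nat \<Rightarrow> (nat \<Rightarrow> complex) \<Rightarrow> complex set set \<Rightarrow> nat \<Rightarrow> nat \<Rightarrow> bool" where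
  "invisible_pair n p LL i j \<longleftrightarrow>
     i < n \<and> j < n \<and> i \<noteq> j \<and> \<not> visible_pair n p LL i j"

text \<open>The vertices and the edges of \<open>\<partial>(p i, p j)\<close>, given by their indices. For \<open>i = j\<close> the walk
  consists of the single vertex \<open>p i\<close>.\<close>

definition bd_verts :: "nat \<Rightarrow> nat \<Rightarrow> nat \<Rightarrow> nat set" where
  "bd_verts n i j = {(i + d) mod n |d. d \<le> (j + n - i) mod n}"

definition bd_edges :: "nat \<Rightarrow> nat \<Rightarrow> nat \<Rightarrow> nat set" where
  "bd_edges n i j = {(i + d) mod n |d. d < (j + n - i) mod n}"


section \<open>Designated blockers\<close>

text \<open>\<open>y\<close> is the point where the ray starting at \<open>p k\<close> and moving away from \<open>p i\<close> first exits the
  polygon: the end of the maximal initial piece of the ray that does not go outside. If the ray goes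
  outside immediately, then \<open>y = p k\<close>; the only edges containing \<open>p k\<close> are the two incident to it,
  and these never lie on the opposite chain in the definition of designated blockers.\<close>

definition first_exit_point ::
    "nat \<Rightarrow> (nat \<Rightarrow> complex) \<Rightarrow> complex set set \<Rightarrow> nat \<Rightarrow> nat \<Rightarrow> complex \<Rightarrow> bool" where
  "first_exit_point n p LL i k y \<longleftrightarrow>
     (let l = line_through p LL i k; r = ray_away l (p k) (p i) in
        y \<in> r \<and> subsegment l (p k) y \<inter> outside (bdry n p LL) = {} \<and>
        (\<forall>z \<in> r. subsegment l (p k) z \<inter> outside (bdry n p LL) = {} \<longrightarrow>
           z \<in> subsegment l (p k) y))"

definition exits_through ::
    "nat \<Rightarrow> (nat \<Rightarrow> complex) \<Rightarrow> complex set set \<Rightarrow> nat \<Rightarrow> nat \<Rightarrow> nat set \<Rightarrow> bool" where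
  "exits_through n p LL i k E \<longleftrightarrow>
     (\<exists>y. first_exit_point n p LL i k y \<and> (\<exists>m \<in> E. y \<in> edge n p LL m))"

definition designated_blocker ::
    "nat \<Rightarrow> (nat \<Rightarrow> complex) \<Rightarrow> complex set set \<Rightarrow> nat \<times> nat \<Rightarrow> nat \<Rightarrow> bool" where
  "designated_blocker n p LL = (\<lambda>(i, j) k.
     invisible_pair n p LL i j \<and> k < n \<and> k \<noteq> i \<and> k \<noteq> j \<and> visible_pair n p LL i k \<and>
     (k \<in> bd_verts n i j \<and> exits_through n p LL i k (bd_edges n j i) \<or>
      k \<in> bd_verts n j i \<and> exits_through n p LL i k (bd_edges n i j)))"


section \<open>Candidate blockers and separable invisible pairs\<close>

definition candidate_blocker ::
    "nat \<Rightarrow> (nat \<Rightarrow> complex) \<Rightarrow> complex set set \<Rightarrow> nat \<times> nat \<Rightarrow> nat \<Rightarrow> bool" where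
  "candidate_blocker n p LL = (\<lambda>(i, j) k.
     invisible_pair n p LL i j \<and> visible_pair n p LL i k \<and>
     (k \<in> bd_verts n i j \<and>
        (\<forall>m \<in> bd_verts n k j - {k}. \<not> visible_pair n p LL i m) \<and>
        \<not> (\<exists>s \<in> bd_verts n i ((k + n - 1) mod n). \<exists>t \<in> bd_verts n ((k + 1) mod n) j.
              visible_pair n p LL s t) \<or>
      k \<in> bd_verts n j i \<and>
        (\<forall>m \<in> bd_verts n j k - {k}. \<not> visible_pair n p LL i m) \<and>
        \<not> (\<exists>s \<in> bd_verts n j ((k + n - 1) mod n). \<exists>t \<in> bd_verts n ((k + 1) mod n) i.
              visible_pair n p LL s t)))"

definition separable ::
    "nat \<Rightarrow> (nat \<Rightarrow> complex) \<Rightarrow> complex set set \<Rightarrow> nat \<Rightarrow> nat \<times> nat \<Rightarrow> nat \<times> nat \<Rightarrow> bool" where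
  "separable n p LL k A B \<longleftrightarrow>
     candidate_blocker n p LL A k \<and> candidate_blocker n p LL B k \<and>
     (\<exists>i j s t. (A = (i, j) \<or> A = (j, i)) \<and> B = (s, t) \<and>
        i \<in> bd_verts n j k \<and> s \<in> bd_verts n k j \<and> t \<in> bd_verts n k j)"

end

theory Submission
  imports Defs
begin

text \<open>If \<open>p k\<close> blocks both pairs, then each viewer \<open>p a\<close>, \<open>p s\<close> has a chord that passes through
  \<open>p k\<close> and ends on the chain, not containing \<open>p k\<close>, between the two vertices of its pair. These
  two chains have no common edge, so the ends of the two chords do not alternate along the
  boundary. But the two chords lie on pseudo-lines that cross at \<open>p k\<close>, so their ends
  must alternate. If both viewers coincide, the chords do too, and one exit point would lie on
  both chains.\<close>

section \<open>Pseudo-lines\<close>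

text \<open>A chord need not be a crosscut of the polygon: it touches the boundary at
  \<open>p k\<close> and may run along an edge up to there, so the disc cannot simply be cut along
  it. Instead the chord of one viewer is closed up by a chain of edges to a compact connected set,
  and the crossing of the two pseudo-lines at \<open>p k\<close> is transferred to this set by
  Janiszewski's theorem. The contradicting connection between the ends of the other chord runs
  through the outside: both ends lie on the boundary, and the outside is connected and misses the
  closed-up chord. The two chains may still share the vertex \<open>p j\<close>. Unless the viewers
  coincide, one of them is off the chain of the other, and this decides which chord is closed
  up.\<close>

lemma subsegment_eq:
  assumes fg: "homeomorphism (UNIV :: real set) l f g" and ab: "a \<in> l" "b \<in> l"
  shows "subsegment l a b = f ` closed_segment (g a) (g b)"
proof -
  \<comment> \<open>For any two parametrizations, \<open>g' \<circ> f\<close> maps an interval to a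
    connected set of reals containing \<open>g' a\<close> and \<open>g' b\<close>, hence everything
    between them. By symmetry all parametrizations cut out the same piece, so the union in the
    definition collapses.\<close>
  have minimal: "f' ` closed_segment (g' a) (g' b) \<subseteq> f ` closed_segment (g a) (g b)"
    if fg: "homeomorphism (UNIV :: real set) l f g"
      and fg': "homeomorphism (UNIV :: real set) l f' g'" for f g f' g'
  proof
    fix x assume "x \<in> f' ` closed_segment (g' a) (g' b)"
    then obtain t where t: "x = f' t" "t \<in> closed_segment (g' a) (g' b)" by blast
    let ?S = "(g' \<circ> f) ` closed_segment (g a) (g b)"
    have "connected ?S"
      using fg fg'
      by (intro connected_continuous_image continuous_on_compose connected_segment)
         (auto simp: homeomorphism_def intro: continuous_on_subset)
    moreover have "g' a \<in> ?S" "g' b \<in> ?S"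
      using homeomorphism_apply2[OF fg] ab by (force simp: image_iff)+
    ultimately have "closed_segment (g' a) (g' b) \<subseteq> ?S"
      by (meson connected_contains_Icc is_interval_connected_1 closed_segment_subset
          is_interval_convex_1)
    with t obtain r where "r \<in> closed_segment (g a) (g b)" "t = g' (f r)" by auto
    with t show "x \<in> f ` closed_segment (g a) (g b)"
      using homeomorphism_apply2[OF fg'] homeomorphism_image1[OF fg] by auto
  qed
  show ?thesis
    unfolding subsegment_def
    using minimal fg by blast
qed

lemma pseudo_line_oriented_parametrization:
  assumes "pseudo_line l" "a \<in> l" "b \<in> l" "a \<noteq> b"
  obtains f g where "homeomorphism (UNIV :: real set) l f g" "g a < g b"
proof -
  obtain f g where fg: "homeomorphism (UNIV :: real set) l f g"
    using assms(1) by (meson homeomorphic_def homeomorphic_sym pseudo_line_def)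
  have "g a \<noteq> g b"
    using homeomorphism_apply2[OF fg] assms by metis
  then consider "g a < g b" | "g b < g a" by linarith
  then show thesis
  proof cases
    case 1
    with fg that show ?thesis by blast
  next
    case 2
    have "homeomorphism (UNIV :: real set) UNIV uminus uminus"
      by (auto simp: homeomorphism_def intro: continuous_intros)
    from that[OF homeomorphism_compose[OF this fg]] 2 show ?thesis by simp
  qed
qed

text \<open>Each half of \<open>m\<close> beyond \<open>x\<close> is connected and misses
  \<open>l\<close>, so it stays on one side of \<open>l\<close>. If both halves were on the same
  side, \<open>m - l\<close> could not visit two sides, as a crossing requires.\<close>

lemma crossing_separates:
  assumes fg: "homeomorphism (UNIV :: real set) m f g"
    and "l \<inter> m = {x}" "crosses_at l m x" "s < g x" "g x < t"
  shows "\<not> connected_component (- l) (f s) (f t)"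
proof
  assume st: "connected_component (- l) (f s) (f t)"
  have cont: "continuous_on A f" for A
    using fg by (auto simp: homeomorphism_def intro: continuous_on_subset)
  have off: "f r \<notin> l" if "r \<noteq> g x" for r
  proof
    assume "f r \<in> l"
    then have "f r = x" using assms(2) homeomorphism_image1[OF fg] by blast
    then show False using that homeomorphism_apply1[OF fg, of r] by simp
  qed
  have below: "connected_component (- l) (f s) (f r)" if "r < g x" for r
    using that assms(4) off
    by (intro connected_componentI[of "f ` {..<g x}"] connected_continuous_image cont) auto
  have above: "connected_component (- l) (f t) (f r)" if "r > g x" for r
    using that assms(5) off
    by (intro connected_componentI[of "f ` {g x<..}"] connected_continuous_image cont) auto
  have "connected_component (- l) (f s) y" if "y \<in> m - l" for y
  proof -
    have y: "y = f (g y)" using that homeomorphism_apply2[OF fg] by auto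
    have "g y \<noteq> g x"
      using that assms(2) homeomorphism_apply2[OF fg] by (metis DiffE Int_iff singletonI)
    then show ?thesis
      using below above st connected_component_trans y by (metis linorder_neqE)
  qed
  then have "connected_component (- l) y z" if "y \<in> m - l" "z \<in> m - l" for y z
    using that connected_component_sym connected_component_trans by metis
  with assms(3) show False
    unfolding crosses_at_def by (metis Int_iff UNIV_I open_UNIV)
qed

text \<open>Near an interior point of a common arc, \<open>J\<close> and \<open>l\<close> have the same two sides. Janiszewski's
  theorem is applied to \<open>J\<close> and the complement of the component of \<open>- (T \<union> (l - arc))\<close> around
  the point: the two sets meet exactly in the connected set \<open>T\<close>.\<close>

lemma same_local_sides:
  fixes l :: "complex set"
  assumes fg: "homeomorphism (UNIV :: real set) l f g" and "closed l"
    and t: "t1 < t0" "t0 < t2"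
    and J: "compact J" "J = f ` {t1<..<t2} \<union> T"
    and T: "closed T" "connected T" "f ` {t1<..<t2} \<inter> T = {}"
  obtains U where "open U" "f t0 \<in> U"
    "\<And>u v. \<lbrakk>u \<in> U; v \<in> U; connected_component (- J) u v\<rbrakk> \<Longrightarrow> connected_component (- l) u v"
proof -
  define arc where "arc = f ` {t1<..<t2}"
  define V where "V = connected_component_set (- (T \<union> (l - arc))) (f t0)"
  have cont: "continuous_on A f" for A
    using fg by (auto simp: homeomorphism_def intro: continuous_on_subset)
  have inl: "f r \<in> l" for r using homeomorphism_image1[OF fg] by auto
  \<comment> \<open>As a preimage under \<open>g\<close> of a closed set, the rest of
    \<open>l\<close> is closed in the closed set \<open>l\<close>.\<close>
  have "l - arc = l \<inter> g -` ({..t1} \<union> {t2..})"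
  proof -
    have "x \<in> arc \<longleftrightarrow> t1 < g x \<and> g x < t2" if "x \<in> l" for x
      using homeomorphism_apply1[OF fg] homeomorphism_apply2[OF fg that]
      unfolding arc_def by (metis (no_types, lifting) greaterThanLessThan_iff imageE imageI UNIV_I)
    then show ?thesis by (auto simp: not_less)
  qed
  then have "closed (l - arc)"
    using continuous_closed_preimage[OF homeomorphism_cont2[OF fg] \<open>closed l\<close>]
    by (metis closed_Un closed_atLeast closed_atMost)
  then have "open V"
    unfolding V_def using T by (intro open_connected_component open_Compl closed_Un)
  have arcV: "arc \<subseteq> V"
    unfolding V_def
  proof (rule connected_component_maximal)
    show "f t0 \<in> arc" using t by (auto simp: arc_def)
    show "connected arc" unfolding arc_def by (intro connected_continuous_image cont) auto
    show "arc \<subseteq> - (T \<union> (l - arc))" using T by (auto simp: arc_def)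
  qed
  have V: "V \<subseteq> - (T \<union> (l - arc))" "connected V"
    unfolding V_def by (rule connected_component_subset) blast
  have "J \<inter> - V = T"
    using arcV V J by (auto simp: arc_def)
  show thesis
  proof (rule that[OF \<open>open V\<close>])
    show "f t0 \<in> V" using arcV t by (auto simp: arc_def)
    fix u v assume uv: "u \<in> V" "v \<in> V" "connected_component (- J) u v"
    \<comment> \<open>The points are joined off \<open>J\<close> by assumption, and off
      \<open>- V\<close> because \<open>V\<close> is connected. The union
      \<open>J \<union> - V\<close> contains \<open>l\<close>, since \<open>J\<close> contains the
      arc and \<open>V\<close> avoids the rest of \<open>l\<close>.\<close>
    have "connected_component (- (J \<union> - V)) u v"
      using uv \<open>J \<inter> - V = T\<close> \<open>open V\<close> T V J(1)
      by (intro Janiszewski) (auto intro: connected_componentI)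
    moreover have "l \<subseteq> J \<union> - V" using V J by (auto simp: arc_def)
    ultimately show "connected_component (- l) u v"
      by (meson Compl_anti_mono connected_component_of_subset)
  qed
qed

section \<open>Chains of boundary edges\<close>

text \<open>Adding \<open>u\<close> modulo \<open>n\<close> permutes the indices, and the offset
  from \<open>u\<close> is the inverse. The predicate \<open>P\<close> lets one computation serve
  both vertices (offset at most that of \<open>v\<close>) and edges (offset strictly
  smaller).\<close>

lemma walk_offset:
  fixes n u v :: nat
  assumes "u < n" "v < n"
  shows "(v + n - u) mod n = (if u \<le> v then v - u else v + n - u)"
    "{(u + d) mod n |d. P d \<and> d < n} =
       {x. x < n \<and> P (if u \<le> x then x - u else x + n - u)}"
proof -
  show shift: "(v + n - u) mod n = (if u \<le> v then v - u else v + n - u)"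
    using assms by (auto simp: mod_if)
  define w where "w x = (if u \<le> x then x - u else x + n - u)" for x
  have w: "w ((u + d) mod n) = d" "(u + d) mod n < n" if "d < n" for d
    using assms that by (cases "u + d < n"; auto simp: w_def mod_if)+
  have w': "x = (u + w x) mod n" "w x < n" if "x < n" for x
    using assms that by (auto simp: w_def mod_if)
  have "x \<in> {(u + d) mod n |d. P d \<and> d < n} \<longleftrightarrow> x < n \<and> P (w x)" for x
  proof
    assume "x \<in> {(u + d) mod n |d. P d \<and> d < n}"
    then obtain d where "x = (u + d) mod n" "P d" "d < n" by blast
    then show "x < n \<and> P (w x)" using w[of d] by simp
  next
    assume x: "x < n \<and> P (w x)"
    show "x \<in> {(u + d) mod n |d. P d \<and> d < n}"
      by (intro CollectI exI[of _ "w x"] conjI w' conjunct1[OF x] conjunct2[OF x])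
  qed
  then have "{(u + d) mod n |d. P d \<and> d < n} = {x. x < n \<and> P (w x)}"
    by (intro set_eqI) (simp only: mem_Collect_eq)
  then show "{(u + d) mod n |d. P d \<and> d < n} =
      {x. x < n \<and> P (if u \<le> x then x - u else x + n - u)}"
    by (simp only: w_def)
qed

text \<open>Replaces modular offsets by inequalities, with the wrap past index \<open>0\<close> as
  the case \<open>u > v\<close>; later questions of cyclic position become case splits.\<close>

lemma mem_bd_verts:
  assumes "u < n" "v < n"
  shows "x \<in> bd_verts n u v \<longleftrightarrow>
    x < n \<and> (if u \<le> v then u \<le> x \<and> x \<le> v else u \<le> x \<or> x \<le> v)"
proof -
  have "(v + n - u) mod n < n" using assms by simp
  then have "bd_verts n u v = {(u + d) mod n |d. d \<le> (v + n - u) mod n \<and> d < n}"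
    unfolding bd_verts_def by (metis order.strict_trans1)
  also have "\<dots> = {x. x < n \<and> (if u \<le> x then x - u else x + n - u) \<le> (v + n - u) mod n}"
    by (rule walk_offset(2)[OF assms])
  finally have "x \<in> bd_verts n u v \<longleftrightarrow> x \<in> \<dots>" by (rule arg_cong)
  then show ?thesis
    unfolding walk_offset(1)[OF assms] mem_Collect_eq using assms
    by (cases "u \<le> v"; cases "u \<le> x") (simp, linarith?)+
qed

lemma mem_bd_edges:
  assumes "u < n" "v < n"
  shows "x \<in> bd_edges n u v \<longleftrightarrow>
    x < n \<and> (if u \<le> v then u \<le> x \<and> x < v else u \<le> x \<or> x < v)"
proof -
  have "(v + n - u) mod n < n" using assms by simp
  then have "bd_edges n u v = {(u + d) mod n |d. d < (v + n - u) mod n \<and> d < n}"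
    unfolding bd_edges_def by (metis order.strict_trans)
  also have "\<dots> = {x. x < n \<and> (if u \<le> x then x - u else x + n - u) < (v + n - u) mod n}"
    by (rule walk_offset(2)[OF assms])
  finally have "x \<in> bd_edges n u v \<longleftrightarrow> x \<in> \<dots>" by (rule arg_cong)
  then show ?thesis
    unfolding walk_offset(1)[OF assms] mem_Collect_eq using assms
    by (cases "u \<le> v"; cases "u \<le> x") (simp, linarith?)+
qed

lemma Suc_mod_eq: "i < n \<Longrightarrow> Suc i mod n = (if Suc i = n then 0 else Suc i)"
  by (auto simp: mod_Suc)

lemma bd_edges_vertices:
  assumes "u < n" "v < n" "m \<in> bd_edges n u v"
  shows "m \<in> bd_verts n u v" "(m + 1) mod n \<in> bd_verts n u v"
  using assms
  by (auto simp: mem_bd_edges mem_bd_verts Suc_mod_eq split: if_splits)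

section \<open>Lines, edges and the boundary curve of a fixed pseudo-polygon\<close>

locale ppolygon =
  fixes n :: nat and p :: "nat \<Rightarrow> complex" and LL :: "complex set set"
  assumes polygon: "pseudo_polygon n p LL"
begin

abbreviation line where "line \<equiv> line_through p LL"
abbreviation side where "side \<equiv> edge n p LL"
abbreviation boundary where "boundary \<equiv> bdry n p LL"
abbreviation chain where "chain u v \<equiv> \<Union>m\<in>bd_edges n u v. side m"

lemma config: "pseudo_configuration n p LL"
  and n3: "n \<ge> 3" and inj_p: "inj_on p {..<n}"
  using polygon by (auto simp: pseudo_polygon_def pseudo_configuration_def)

lemma suc_mod: "i < n \<Longrightarrow> (i + 1) mod n < n \<and> (i + 1) mod n \<noteq> i"
  using n3 by (auto simp: mod_Suc)

lemma pseudo_line_LL: "l \<in> LL \<Longrightarrow> pseudo_line l"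
  and closed_LL: "l \<in> LL \<Longrightarrow> closed l"
  using config
  by (auto simp: pseudo_configuration_def pseudo_line_arrangement_def pseudo_line_def)

lemma crossing:
  assumes "l \<in> LL" "m \<in> LL" "l \<noteq> m" "x \<in> l" "x \<in> m"
  shows "l \<inter> m = {x}" "crosses_at l m x"
proof -
  have "\<exists>y. l \<inter> m = {y} \<and> crosses_at l m y"
    using config assms
    by (auto simp: pseudo_configuration_def pseudo_line_arrangement_def)
  then obtain y where y: "l \<inter> m = {y}" "crosses_at l m y" by blast
  have "x \<in> l \<inter> m" using assms by blast
  then have "x = y" unfolding y(1) by simp
  with y show "l \<inter> m = {x}" "crosses_at l m x" by simp_all
qed

lemma line_props:
  assumes "i < n" "j < n" "i \<noteq> j"
  shows "line i j \<in> LL" "p i \<in> line i j" "p j \<in> line i j"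
proof -
  have "\<exists>!l. l \<in> LL \<and> p i \<in> l \<and> p j \<in> l"
    using config assms by (auto simp: pseudo_configuration_def)
  from theI'[OF this] show "line i j \<in> LL" "p i \<in> line i j" "p j \<in> line i j"
    by (auto simp: line_through_def)
qed

lemma vertex_on_line:
  assumes "i < n" "j < n" "i \<noteq> j" "v < n" "p v \<in> line i j"
  shows "v = i \<or> v = j"
proof (rule ccontr)
  assume *: "\<not> (v = i \<or> v = j)"
  have "card (line i j \<inter> p ` {..<n}) = 2"
    using config line_props[OF assms(1-3)] by (auto simp: pseudo_configuration_def)
  moreover have "p ` {i, j, v} \<subseteq> line i j \<inter> p ` {..<n}"
    using assms line_props[OF assms(1-3)] by auto
  moreover have "card (p ` {i, j, v}) = 3"
    using * assms by (subst card_image[OF inj_on_subset[OF inj_p]]) auto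
  ultimately show False
    using card_mono[of "line i j \<inter> p ` {..<n}" "p ` {i, j, v}"] by simp
qed

lemma side_parametrization:
  assumes "m < n"
  obtains f g where
    "homeomorphism (UNIV :: real set) (line m ((m + 1) mod n)) f g"
    "g (p m) < g (p ((m + 1) mod n))"
    "side m = f ` {g (p m) .. g (p ((m + 1) mod n))}"
proof -
  let ?m = "(m + 1) mod n"
  have m: "?m < n" "m \<noteq> ?m" using suc_mod[OF assms] by auto
  note L = line_props[OF assms m]
  have "p m \<noteq> p ?m" using inj_p m assms by (auto simp: inj_on_def)
  then obtain f g where fg: "homeomorphism (UNIV :: real set) (line m ?m) f g"
      "g (p m) < g (p ?m)"
    using pseudo_line_oriented_parametrization[OF pseudo_line_LL[OF L(1)] L(2,3)] by blast
  moreover have "side m = f ` {g (p m) .. g (p ?m)}"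
    unfolding edge_def segm_def subsegment_eq[OF fg(1) L(2,3)]
    using fg(2) by (simp add: closed_segment_eq_real_ivl)
  ultimately show thesis using that by blast
qed

lemma side_props:
  assumes "m < n"
  shows "side m \<subseteq> line m ((m + 1) mod n)" "compact (side m)" "connected (side m)"
    "p m \<in> side m" "p ((m + 1) mod n) \<in> side m"
proof -
  let ?m = "(m + 1) mod n"
  have m: "?m < n" "m \<noteq> ?m" using suc_mod[OF assms] by auto
  obtain f g where fg: "homeomorphism (UNIV :: real set) (line m ?m) f g"
    "g (p m) < g (p ?m)" "side m = f ` {g (p m) .. g (p ?m)}"
    using side_parametrization[OF assms] .
  have cont: "continuous_on A f" for A
    using fg by (auto simp: homeomorphism_def intro: continuous_on_subset)
  show "side m \<subseteq> line m ?m" using fg(3) homeomorphism_image1[OF fg(1)] by auto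
  show "compact (side m)" "connected (side m)"
    unfolding fg(3) by (auto intro!: compact_continuous_image connected_continuous_image cont)
  have "f (g (p m)) = p m" "f (g (p ?m)) = p ?m"
    using line_props[OF assms m] homeomorphism_apply2[OF fg(1)] by auto
  then show "p m \<in> side m" "p ?m \<in> side m"
    unfolding fg(3) using fg(2) by (metis atLeastAtMost_iff image_eqI less_imp_le order_refl)+
qed

lemma vertex_on_side:
  assumes "m < n" "v < n" "p v \<in> side m"
  shows "v = m \<or> v = (m + 1) mod n"
  using vertex_on_line[of m "(m + 1) mod n" v] side_props(1)[OF assms(1)] suc_mod[OF assms(1)] assms
  by auto

lemma sides_meet_at_vertex:
  assumes "m < n" "m' < n" "m \<noteq> m'" "x \<in> side m" "x \<in> side m'"
  obtains v where "v < n" "x = p v"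
proof -
  have adj: "side i \<inter> side ((i + 1) mod n) = {p ((i + 1) mod n)}" if "i < n" for i
    using polygon that by (auto simp: pseudo_polygon_def)
  have "m' = (m + 1) mod n \<or> m = (m' + 1) mod n"
    using polygon assms unfolding pseudo_polygon_def by blast
  then show thesis
  proof
    assume "m' = (m + 1) mod n"
    with adj[OF assms(1)] assms show thesis by (intro that[of m']) auto
  next
    assume "m = (m' + 1) mod n"
    with adj[OF assms(2)] assms show thesis by (intro that[of m]) auto
  qed
qed

lemma vertex_in_chain:
  assumes "u < n" "v < n" "w < n" "p w \<in> chain u v"
  shows "w \<in> bd_verts n u v"
proof -
  obtain m where m: "m \<in> bd_edges n u v" "p w \<in> side m" using assms by blast
  moreover from m have "m < n" using assms by (simp add: mem_bd_edges)
  ultimately show ?thesis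
    using vertex_on_side assms bd_edges_vertices by metis
qed

lemma chain_ends:
  assumes "u < n" "v < n" "u \<noteq> v"
  shows "p u \<in> chain u v" "p v \<in> chain u v"
proof -
  have "u \<in> bd_edges n u v" using assms by (auto simp: mem_bd_edges)
  with side_props(4)[OF assms(1)] show "p u \<in> chain u v" by blast
  define w where "w = (if v = 0 then n - 1 else v - 1)"
  have w: "w < n" "(w + 1) mod n = v" using assms by (auto simp: w_def)
  have "w \<in> bd_edges n u v"
    using assms by (auto simp: mem_bd_edges w_def)
  with side_props(5)[OF w(1)] w show "p v \<in> chain u v" by auto
qed

lemma chain_compact_connected:
  assumes "u < n" "v < n"
  shows "compact (chain u v)" "connected (chain u v)"
proof -
  have "finite (bd_edges n u v)"
    unfolding bd_edges_def by auto
  then show "compact (chain u v)"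
    using side_props(2) assms by (intro compact_UN) (auto simp: mem_bd_edges)
  \<comment> \<open>Induction on the number of edges walked: the new edge meets the previous one in
    their common vertex \<open>p ((u + D) mod n)\<close>.\<close>
  have "connected (\<Union>d<D. side ((u + d) mod n))" for D
  proof (induction D)
    case (Suc D)
    have "0 < n" using assms by simp
    then have c: "connected (side ((u + D) mod n))" by (intro side_props(3)) simp
    show ?case
    proof (cases D)
      case 0
      with c show ?thesis by (simp add: lessThan_Suc)
    next
      case (Suc D')
      have "p ((u + D) mod n) \<in> side ((u + D') mod n)"
        using side_props(5)[of "(u + D') mod n"] \<open>0 < n\<close> Suc by (simp add: mod_simps)
      moreover have "p ((u + D) mod n) \<in> side ((u + D) mod n)"
        using side_props(4)[of "(u + D) mod n"] \<open>0 < n\<close> by simp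
      ultimately have "(\<Union>d<D. side ((u + d) mod n)) \<inter> side ((u + D) mod n) \<noteq> {}"
        using Suc by blast
      from connected_Un[OF Suc.IH c this] show ?thesis
        by (simp add: lessThan_Suc Un_commute)
    qed
  qed simp
  moreover have "chain u v = (\<Union>d<(v + n - u) mod n. side ((u + d) mod n))"
    unfolding bd_edges_def by blast
  ultimately show "connected (chain u v)" by simp
qed

lemma boundary_simple_closed:
  obtains c where "simple_path c" "pathfinish c = pathstart c" "path_image c = boundary"
proof -
  obtain c where c: "simple_path c" "pathfinish c = pathstart c"
    "\<forall>i<n. c (real i / real n) = p i \<and> c ` {real i / real n .. real (i + 1) / real n} = side i"
    using polygon unfolding pseudo_polygon_def ccw_indexed_def by (elim conjE exE) (rule that)
  have n: "real n > 0" using n3 by simp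
  have "\<exists>i<n. t \<in> {real i / real n .. real (i + 1) / real n}" if t: "t \<in> {0..1}" for t
  \<comment> \<open>For \<open>t = 1\<close> the floor would give the index \<open>n\<close>, so the
    last interval is named explicitly.\<close>
  proof (cases "t = 1")
    case True
    then show ?thesis using n by (intro exI[of _ "n - 1"]) (auto simp: field_simps)
  next
    case False
    define i where "i = nat \<lfloor>t * real n\<rfloor>"
    have "real i \<le> t * real n" "t * real n < real i + 1"
      using t n unfolding i_def by (auto simp: of_nat_nat)
    moreover have "t * real n < real n" using t False n by auto
    ultimately have "i < n" by linarith
    with \<open>real i \<le> t * real n\<close> \<open>t * real n < real i + 1\<close> n show ?thesis
      by (intro exI[of _ i]) (auto simp: field_simps)
  qed
  moreover have "{real i / real n .. real (i + 1) / real n} \<subseteq> {0..1}" if "i < n" for i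
  proof -
    have "real (i + 1) \<le> real n" using that by simp
    then have "real (i + 1) / real n \<le> 1" using n by (simp add: field_simps)
    moreover have "0 \<le> real i / real n" by simp
    ultimately show ?thesis by (simp only: atLeastatMost_subset_iff) simp
  qed
  ultimately have unit: "{0..1} = (\<Union>i<n. {real i / real n .. real (i + 1) / real n})" by blast
  have "path_image c = (\<Union>i<n. c ` {real i / real n .. real (i + 1) / real n})"
    unfolding path_image_def unit by (rule image_UN)
  also have "\<dots> = (\<Union>i<n. side i)"
    by (intro SUP_cong refl) (use c(3) in blast)
  finally have "path_image c = (\<Union>i<n. side i)" .
  with c that show thesis by (simp add: bdry_def)
qed

text \<open>The Jordan curve theorem for the boundary. The frontier clause is what makes every
  boundary point reachable from the outside.\<close>

lemma boundary_props:
  shows "compact boundary" "connected (inside boundary)" "connected (outside boundary)"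
    "frontier (outside boundary) = boundary"
proof -
  obtain c where c: "simple_path c" "pathfinish c = pathstart c" "path_image c = boundary"
    using boundary_simple_closed .
  from Jordan_inside_outside[OF c(1,2)] c
  show "connected (inside boundary)" "connected (outside boundary)"
    "frontier (outside boundary) = boundary" by auto
  show "compact boundary"
    using c by (metis compact_path_image simple_path_imp_path)
qed

section \<open>Chords through a vertex\<close>

text \<open>A pseudo-line that meets the relative interior of a boundary edge changes between the inside
  and the outside there.\<close>

lemma exits_at_interior_of_side:
  assumes e: "e < n" and m: "m \<in> LL" "m \<noteq> line e ((e + 1) mod n)"
    and fg: "homeomorphism (UNIV :: real set) m f g"
    and x: "f t0 \<in> side e" "f t0 \<notin> p ` {..<n}"
    and t: "t1 < t0" "t0 < t2"
  shows "f ` {t1..t2} \<inter> outside boundary \<noteq> {}"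
proof
  assume in_closed: "f ` {t1..t2} \<inter> outside boundary = {}"
  define e' where "e' = (e + 1) mod n"
  define l where "l = line e e'"
  \<comment> \<open>All edges except \<open>e\<close>. The boundary is the open arc of
    \<open>side e\<close> together with this closed connected set, the shape that
    \<open>same_local_sides\<close> asks for.\<close>
  define T where "T = chain e' e"
  have e': "e' < n" "e \<noteq> e'" using suc_mod[OF e] by (auto simp: e'_def)
  have l: "l \<in> LL" "p e \<in> l" "p e' \<in> l" using line_props[OF e e'] by (auto simp: l_def)
  obtain F G where FG: "homeomorphism (UNIV :: real set) l F G" "G (p e) < G (p e')"
    "side e = F ` {G (p e) .. G (p e')}"
    using side_parametrization[OF e] unfolding l_def e'_def .
  have FG_ends: "F (G (p e)) = p e" "F (G (p e')) = p e'"
    using homeomorphism_apply2[OF FG(1)] l by auto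
  have T: "closed T" "connected T"
    using chain_compact_connected[OF e'(1) e] by (auto simp: T_def compact_imp_closed)
  have e'_eq: "e' = (if Suc e = n then 0 else Suc e)"
    using Suc_mod_eq[OF e] by (simp add: e'_def)
  have "x \<in> bd_edges n e' e \<longleftrightarrow> x \<in> {..<n} - {e}" for x
    unfolding mem_bd_edges[OF e'(1) e] using e e'_eq n3 by auto
  then have edges: "bd_edges n e' e = {..<n} - {e}" by blast
  \<comment> \<open>A point on two edges is a vertex, and the only vertices on \<open>side e\<close>
    are its two ends.\<close>
  have arc_off_T: "F r \<notin> T" if r: "r \<in> {G (p e)<..<G (p e')}" for r
  proof
    assume "F r \<in> T"
    then obtain m' where m': "m' < n" "m' \<noteq> e" "F r \<in> side m'"
      unfolding T_def edges by auto
    moreover have Fr: "F r \<in> side e" using r FG by auto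
    ultimately obtain v where v: "v < n" "F r = p v"
      using sides_meet_at_vertex e by metis
    then have "v = e \<or> v = e'" using vertex_on_side[OF e] Fr by (auto simp: e'_def)
    then have "G (F r) = G (p e) \<or> G (F r) = G (p e')" using v by auto
    then show False using r homeomorphism_apply1[OF FG(1)] by auto
  qed
  have bdry_eq: "boundary = F ` {G (p e)<..<G (p e')} \<union> T"
  proof -
    have "boundary = side e \<union> T" unfolding bdry_def T_def edges using e by auto
    moreover have "{G (p e) .. G (p e')} = {G (p e)<..<G (p e')} \<union> {G (p e), G (p e')}"
      using FG(2) by auto
    moreover have "p e \<in> T" "p e' \<in> T"
      using chain_ends[OF e'(1) e] e' by (auto simp: T_def)
    ultimately show ?thesis using FG(3) FG_ends by auto
  qed
  obtain r where r: "f t0 = F r" "r \<in> {G (p e)<..<G (p e')}"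
  proof -
    obtain r where r: "f t0 = F r" "r \<in> {G (p e) .. G (p e')}" using x FG by auto
    moreover have "r \<noteq> G (p e)" "r \<noteq> G (p e')"
      using r x e e' FG_ends by auto
    ultimately show thesis using that by auto
  qed
  then have r': "G (p e) < r" "r < G (p e')" by auto
  have disj: "F ` {G (p e)<..<G (p e')} \<inter> T = {}" using arc_off_T by auto
  obtain U where U: "open U" "F r \<in> U"
    "\<And>u v. \<lbrakk>u \<in> U; v \<in> U; connected_component (- boundary) u v\<rbrakk> \<Longrightarrow> connected_component (- l) u v"
    using same_local_sides[OF FG(1) closed_LL[OF l(1)] r' boundary_props(1) bdry_eq T disj]
    by metis
  have "f t0 \<in> l" unfolding r(1) using homeomorphism_image1[OF FG(1)] by blast
  moreover have "f t0 \<in> m" using homeomorphism_image1[OF fg] by blast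
  moreover have "l \<noteq> m" using m(2) by (simp add: l_def e'_def)
  ultimately have fx: "f t0 \<in> l" "f t0 \<in> m" "l \<noteq> m" by blast+
  note cross = crossing[OF l(1) m(1) fx(3,1,2)]
  have gf: "g (f t) = t" for t using homeomorphism_apply1[OF fg] by auto
  have "open (f -` (U - T))"
    using U T fg by (intro open_vimage) (auto simp: homeomorphism_def)
  moreover have "t0 \<in> f -` (U - T)" using U r arc_off_T by auto
  ultimately obtain d where d: "d > 0" "\<And>s. \<bar>s - t0\<bar> < d \<Longrightarrow> f s \<in> U - T"
    unfolding open_dist by (auto simp: dist_real_def)
  \<comment> \<open>Close to the meeting point, \<open>m\<close> avoids \<open>T\<close> and, by the
    single intersection, also \<open>l\<close>. So it is off the boundary, and staying out of the
    outside forces it inside.\<close>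
  have near: "f s \<in> inside boundary \<and> f s \<in> U"
    if "\<bar>s - t0\<bar> < d" "s \<noteq> t0" "t1 \<le> s" "s \<le> t2" for s
  proof -
    have "f s \<in> m" using homeomorphism_image1[OF fg] by auto
    moreover have "f s \<noteq> f t0" using gf that(2) by metis
    ultimately have "f s \<notin> l" using cross by auto
    then have "f s \<notin> F ` {G (p e)<..<G (p e')}"
      using homeomorphism_image1[OF FG(1)] by auto
    then have "f s \<notin> boundary" using d(2)[OF that(1)] bdry_eq by auto
    moreover have "f s \<in> f ` {t1..t2}" using that by simp
    then have "f s \<notin> outside boundary" using in_closed by blast
    ultimately show ?thesis
      using d(2)[OF that(1)] inside_Un_outside[of boundary] by blast
  qed
  \<comment> \<open>Halving \<open>d\<close> keeps the two test points strictly within the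
    neighbourhood; the other bounds keep them in the parameter range.\<close>
  define h where "h = min (d / 2) (min (t0 - t1) (t2 - t0))"
  have h: "h > 0" "h < d" "h \<le> t0 - t1" "h \<le> t2 - t0" using d t by (auto simp: h_def)
  have "f (t0 - h) \<in> inside boundary" "f (t0 - h) \<in> U" "f (t0 + h) \<in> inside boundary" "f (t0 + h) \<in> U"
    using near[of "t0 - h"] near[of "t0 + h"] h by auto
  moreover have "inside boundary \<subseteq> - boundary" using inside_Un_outside by blast
  \<comment> \<open>The inside joins the two test points without meeting the boundary; near the edge
    this means they are on the same side of \<open>l\<close>.\<close>
  ultimately have "connected_component (- l) (f (t0 - h)) (f (t0 + h))"
    by (intro U(3) connected_componentI[OF boundary_props(2)])
  with crossing_separates[OF fg cross, of "t0 - h" "t0 + h"] gf h show False by simp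
qed

text \<open>Membership in the ray puts \<open>g (p k)\<close> between \<open>g (p a)\<close> and
  \<open>g y\<close>, so after orienting the line the order \<open>p a\<close>, \<open>p k\<close>,
  \<open>y\<close> is forced. This turns both pieces of a chord into real intervals.\<close>

lemma ray_parametrization:
  assumes ak: "a < n" "k < n" "a \<noteq> k"
    and y: "y \<in> ray_away (line a k) (p k) (p a)" "y \<noteq> p k"
  obtains f g where "homeomorphism (UNIV :: real set) (line a k) f g"
    "g (p a) < g (p k)" "g (p k) < g y" "f (g (p a)) = p a" "f (g (p k)) = p k" "f (g y) = y"
    "segm p LL a k = f ` {g (p a)..g (p k)}"
    "subsegment (line a k) (p k) y = f ` {g (p k)..g y}"
proof -
  note L = line_props[OF ak]
  have "p a \<noteq> p k" using inj_p ak by (auto simp: inj_on_def)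
  then obtain f g where fg: "homeomorphism (UNIV :: real set) (line a k) f g"
      "g (p a) < g (p k)"
    using pseudo_line_oriented_parametrization[OF pseudo_line_LL[OF L(1)] L(2,3)] by blast
  have yl: "y \<in> line a k" using y by (auto simp: ray_away_def)
  have inv: "f (g (p a)) = p a" "f (g (p k)) = p k" "f (g y) = y"
    using homeomorphism_apply2[OF fg(1)] L yl by auto
  have "p k \<in> f ` closed_segment (g (p a)) (g y)"
    using y subsegment_eq[OF fg(1) L(2) yl] by (simp add: ray_away_def)
  then have "g (p k) \<in> closed_segment (g (p a)) (g y)"
    using homeomorphism_apply1[OF fg(1)] by auto
  moreover have "g (p k) \<noteq> g y" using inv y(2) by metis
  ultimately have "g (p k) < g y"
    using fg(2) by (auto simp: closed_segment_eq_real_ivl split: if_splits)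
  with that[OF fg _ inv] show thesis
    using fg(2) subsegment_eq[OF fg(1) L(2,3)] subsegment_eq[OF fg(1) L(3) yl]
    by (simp add: segm_def closed_segment_eq_real_ivl)
qed

text \<open>Two chords through \<open>p k\<close> cross there, hence their ends alternate on the boundary. Completing
  the chord from \<open>p a\<close> to \<open>y\<close> by a chain of edges that contains its two ends, but no end of the
  other chord, gives a set that does not separate the ends of the other chord, although
  that chord crosses it exactly once.\<close>

lemma chords_through_vertex_alternate:
  assumes vis: "visible_pair n p LL a k" "visible_pair n p LL s k" and "a \<noteq> s"
    and y: "first_exit_point n p LL a k y" and z: "first_exit_point n p LL s k z"
    and uv: "u < n" "v < n" "u \<noteq> v" "a = u \<or> a = v"
    and k: "k \<notin> bd_verts n u v" and s: "s \<notin> bd_verts n u v"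
    and yC: "y \<in> chain u v" and zC: "z \<in> boundary" "z \<notin> chain u v" "z \<noteq> p k"
  shows False
proof -
  define C where "C = chain u v"
  define l where "l = line a k"
  define m where "m = line s k"
  have idx: "a < n" "k < n" "a \<noteq> k" "s < n" "s \<noteq> k"
    using vis by (auto simp: visible_pair_def)
  have kC: "p k \<notin> C" and sC: "p s \<notin> C"
    using vertex_in_chain[OF uv(1,2)] idx k s by (auto simp: C_def)
  have aC: "p a \<in> C" using chain_ends[OF uv(1-3)] uv(4) by (auto simp: C_def)
  have C: "compact C" "connected C" using chain_compact_connected uv by (auto simp: C_def)
  have CB: "C \<subseteq> boundary" using uv by (auto simp: C_def bdry_def mem_bd_edges)
  have y': "y \<in> ray_away l (p k) (p a)" "subsegment l (p k) y \<inter> outside boundary = {}"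
    using y by (auto simp: first_exit_point_def Let_def l_def)
  have z': "z \<in> ray_away m (p k) (p s)" "subsegment m (p k) z \<inter> outside boundary = {}"
    using z by (auto simp: first_exit_point_def Let_def m_def)
  have "y \<noteq> p k" using yC kC by (auto simp: C_def)
  then obtain f g where fg: "homeomorphism (UNIV :: real set) l f g"
    "g (p a) < g (p k)" "g (p k) < g y" "f (g (p a)) = p a" "f (g (p k)) = p k" "f (g y) = y"
    "segm p LL a k = f ` {g (p a)..g (p k)}" "subsegment l (p k) y = f ` {g (p k)..g y}"
    using ray_parametrization[OF idx(1-3), of y] y' unfolding l_def by metis
  obtain f' g' where fg': "homeomorphism (UNIV :: real set) m f' g'"
    "g' (p s) < g' (p k)" "g' (p k) < g' z" "f' (g' (p s)) = p s" "f' (g' (p k)) = p k" "f' (g' z) = z"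
    "segm p LL s k = f' ` {g' (p s)..g' (p k)}" "subsegment m (p k) z = f' ` {g' (p k)..g' z}"
    using ray_parametrization[OF idx(4,2,5), of z] z' zC unfolding m_def by metis
  have cont: "continuous_on A f" for A
    using fg by (auto simp: homeomorphism_def intro: continuous_on_subset)
  have cont': "continuous_on A f'" for A
    using fg' by (auto simp: homeomorphism_def intro: continuous_on_subset)
  have gf: "g (f t) = t" for t using homeomorphism_apply1[OF fg(1)] by auto
  have gf': "g' (f' t) = t" for t using homeomorphism_apply1[OF fg'(1)] by auto
  have fl: "f t \<in> l" and fm: "f' t \<in> m" for t
    using homeomorphism_image1[OF fg(1)] homeomorphism_image1[OF fg'(1)] by auto
  have l: "l \<in> LL" "p a \<in> l" "p k \<in> l" and m: "m \<in> LL" "p s \<in> m" "p k \<in> m"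
    using line_props idx by (auto simp: l_def m_def)
  have "l \<noteq> m"
  proof
    assume "l = m"
    then have "s = a \<or> s = k"
      using vertex_on_line[OF idx(1-4)] m by (simp add: l_def)
    then show False using idx \<open>a \<noteq> s\<close> by auto
  qed
  note cross = crossing[OF l(1) m(1) this l(3) m(3)]
  define J where "J = f ` {g (p a)..g y} \<union> C"

  \<comment> \<open>A window of the chord around \<open>p k\<close> that avoids \<open>C\<close>; it
    exists because \<open>p k\<close> is off the closed set \<open>C\<close>.\<close>
  obtain t1 t2 where t: "g (p a) \<le> t1" "t1 < g (p k)" "g (p k) < t2" "t2 \<le> g y"
    and near_k: "\<And>t. t1 < t \<Longrightarrow> t < t2 \<Longrightarrow> f t \<notin> C"
  proof -
    have "open (f -` (- C))"
      using C fg by (intro open_vimage) (auto simp: homeomorphism_def compact_imp_closed open_Compl)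
    moreover have "g (p k) \<in> f -` (- C)" using kC fg by auto
    ultimately obtain d where d: "d > 0" "\<And>t. \<bar>t - g (p k)\<bar> < d \<Longrightarrow> f t \<notin> C"
      unfolding open_dist by (auto simp: dist_real_def)
    show thesis
      by (rule that[of "max (g (p a)) (g (p k) - d)" "min (g y) (g (p k) + d)"])
         (use d fg in auto)
  qed
  \<comment> \<open>\<open>J\<close> without the window. It stays connected because \<open>C\<close>
    ties the two remaining pieces together at \<open>p a\<close> and \<open>y\<close>.\<close>
  define T where "T = f ` {g (p a)..t1} \<union> C \<union> f ` {t2..g y}"
  have T: "connected T"
    unfolding T_def
  proof (intro connected_Un connected_continuous_image cont C)
    show "f ` {g (p a)..t1} \<inter> C \<noteq> {}" using aC t fg(4) by force
    have "y \<in> f ` {t2..g y}" using t fg(6) by force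
    then show "(f ` {g (p a)..t1} \<union> C) \<inter> f ` {t2..g y} \<noteq> {}"
      using yC by (auto simp: C_def)
  qed auto
  have T_closed: "closed T"
    unfolding T_def
    by (intro closed_Un compact_imp_closed C compact_continuous_image cont) auto
  have J_compact: "compact J"
    unfolding J_def by (intro compact_Un C compact_continuous_image cont) auto
  have "{g (p a)..g y} = {g (p a)..t1} \<union> {t1<..<t2} \<union> {t2..g y}" using t by auto
  then have J_eq: "J = f ` {t1<..<t2} \<union> T"
    unfolding J_def T_def by auto
  have disj: "f ` {t1<..<t2} \<inter> T = {}"
  proof -
    have "f r \<notin> f ` {g (p a)..t1}" "f r \<notin> f ` {t2..g y}" if "t1 < r" "r < t2" for r
      using that gf by (metis atLeastAtMost_iff imageE not_less)+
    then have "f r \<notin> T" if "t1 < r" "r < t2" for r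
      using that near_k unfolding T_def by blast
    then show ?thesis by auto
  qed
  obtain U where U: "open U" "p k \<in> U"
    "\<And>u v. \<lbrakk>u \<in> U; v \<in> U; connected_component (- J) u v\<rbrakk> \<Longrightarrow> connected_component (- l) u v"
    using same_local_sides[OF fg(1) closed_LL[OF l(1)] t(2,3) J_compact J_eq T_closed T disj] fg(5)
    by metis

  have in_s: "f' t \<notin> outside boundary" if "g' (p s) \<le> t" "t \<le> g' (p k)" for t
  proof -
    have "f' t \<in> segm p LL s k" using fg'(7) that by simp
    then show ?thesis using vis(2) unfolding visible_pair_def by blast
  qed
  have in_z: "f' t \<notin> outside boundary" if "g' (p k) \<le> t" "t \<le> g' z" for t
  proof -
    have "f' t \<in> subsegment m (p k) z" using fg'(8) that by simp
    then show ?thesis using z'(2) by blast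
  qed
  \<comment> \<open>The ends of the second chord and \<open>p k\<close> are off \<open>C\<close>.
    Any other common point is no vertex, since \<open>m\<close> carries only \<open>p s\<close> and
    \<open>p k\<close>, and \<open>m\<close> is not the line of the edge, since \<open>p k\<close>
    is no end of an edge of \<open>C\<close>. So the chord would go outside there, but neither of
    its two pieces does.\<close>
  have off_C: "f' t \<notin> C" if "g' (p s) \<le> t" "t \<le> g' z" for t
  proof
    assume ftC: "f' t \<in> C"
    then have ne: "t \<noteq> g' (p s)" "t \<noteq> g' (p k)" "t \<noteq> g' z"
      using sC kC zC fg' by (auto simp: C_def)
    from ftC obtain e where e: "e \<in> bd_edges n u v" "f' t \<in> side e" by (auto simp: C_def)
    have en: "e < n" using e uv by (simp add: mem_bd_edges)
    have "m \<noteq> line e ((e + 1) mod n)"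
    proof
      assume "m = line e ((e + 1) mod n)"
      then have "k = e \<or> k = (e + 1) mod n"
        using vertex_on_line[of e "(e + 1) mod n" k] m(3) suc_mod[OF en] en idx by auto
      then show False using bd_edges_vertices[OF uv(1,2) e(1)] k by auto
    qed
    moreover have "f' t \<notin> p ` {..<n}"
    proof
      assume "f' t \<in> p ` {..<n}"
      then obtain w where w: "w < n" "f' t = p w" by auto
      then have "w = s \<or> w = k"
        using vertex_on_line[OF idx(4,2,5) w(1)] fm[of t] by (auto simp: m_def)
      then show False using w ne gf' by metis
    qed
    ultimately have exits: "f' ` {t1..t2} \<inter> outside boundary \<noteq> {}" if "t1 < t" "t < t2" for t1 t2
      using exits_at_interior_of_side[OF en m(1) _ fg'(1) e(2)] that by blast
    show False
    proof (cases "t < g' (p k)")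
      case True
      then show False using exits[of "g' (p s)" "g' (p k)"] in_s ne that by force
    next
      case False
      then show False using exits[of "g' (p k)" "g' z"] in_z ne that by force
    qed
  qed
  have off_J: "f' t \<notin> J" if "g' (p s) \<le> t" "t \<le> g' z" "t \<noteq> g' (p k)" for t
  proof -
    have "f' t \<noteq> p k" using that gf' by metis
    then have "f' t \<notin> l" using fm cross(1) by auto
    then show ?thesis using off_C[OF that(1,2)] fl by (auto simp: J_def)
  qed
  have J_out: "outside boundary \<subseteq> - J"
  proof -
    have "f t \<notin> outside boundary" if "g (p a) \<le> t" "t \<le> g y" for t
    proof (cases "t \<le> g (p k)")
      case True
      then have "f t \<in> segm p LL a k" using fg(7) that by simp
      then show ?thesis using vis(1) unfolding visible_pair_def by blast
    next
      case False
      then have "f t \<in> subsegment l (p k) y" using fg(8) that by simp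
      then show ?thesis using y'(2) by blast
    qed
    moreover have "boundary \<inter> outside boundary = {}"
      using inside_Un_outside[of boundary] by blast
    ultimately show ?thesis using CB by (auto simp: J_def)
  qed
  \<comment> \<open>A boundary point is a limit of outside points; a small ball around it that
    misses \<open>J\<close> contains one of them.\<close>
  have reach: "\<exists>o'\<in>outside boundary. connected_component (- J) x o'"
    if x: "x \<in> boundary" "x \<notin> J" for x
  proof -
    have "open (- J)" using J_compact by (simp add: compact_imp_closed open_Compl)
    then obtain r where r: "r > 0" "ball x r \<subseteq> - J"
      using x(2) unfolding open_contains_ball by blast
    have "x \<in> closure (outside boundary)"
      using x(1) boundary_props(4) by (metis frontier_def DiffD1)
    then obtain w where w: "w \<in> outside boundary" "dist w x < r"
      using r(1) closure_approachable by blast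
    have "connected_component (- J) x w"
      by (rule connected_componentI[of "ball x r"]) (use r w in \<open>auto simp: dist_commute\<close>)
    with w show ?thesis by blast
  qed
  have "p s \<in> boundary" using side_props(4)[OF idx(4)] idx(4) by (auto simp: bdry_def)
  moreover have "p s \<notin> J" "z \<notin> J"
    using off_J[of "g' (p s)"] off_J[of "g' z"] fg' by auto
  ultimately obtain o1 o2 where o: "o1 \<in> outside boundary" "o2 \<in> outside boundary"
    "connected_component (- J) (p s) o1" "connected_component (- J) z o2"
    using reach zC(1) by meson
  moreover have "connected_component (- J) o1 o2"
    by (rule connected_componentI[OF boundary_props(3) J_out o(1,2)])
  \<comment> \<open>The ends of the second chord are joined off \<open>J\<close> by a detour through
    the connected outside.\<close>
  ultimately have sz: "connected_component (- J) (p s) z"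
    by (meson connected_component_sym connected_component_trans)

  have "open (f' -` U)"
    using U fg' by (intro open_vimage) (auto simp: homeomorphism_def)
  moreover have "g' (p k) \<in> f' -` U" using U fg' by auto
  ultimately obtain d where d: "d > 0" "\<And>t. \<bar>t - g' (p k)\<bar> < d \<Longrightarrow> f' t \<in> U"
    unfolding open_dist by (auto simp: dist_real_def)
  define h where "h = min (d / 2) (min (g' (p k) - g' (p s)) (g' z - g' (p k)))"
  have h: "h > 0" "h < d" "g' (p s) \<le> g' (p k) - h" "g' (p k) + h \<le> g' z"
    using d fg' by (auto simp: h_def)
  have walk: "connected_component (- J) (f' t1) (f' t2)"
    if "t1 \<le> t2" "\<And>t. t1 \<le> t \<Longrightarrow> t \<le> t2 \<Longrightarrow> f' t \<notin> J" for t1 t2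
    by (rule connected_componentI[of "f' ` {t1..t2}"])
       (use that in \<open>auto intro!: connected_continuous_image cont'\<close>)
  have "connected_component (- J) (f' (g' (p s))) (f' (g' (p k) - h))"
    using h off_J fg'(2,3) by (intro walk) auto
  then have "connected_component (- J) (f' (g' (p k) - h)) (p s)"
    unfolding fg'(4) by (rule connected_component_sym)
  moreover have "connected_component (- J) (f' (g' (p k) + h)) (f' (g' z))"
    using h off_J fg'(2,3) by (intro walk) auto
  then have "connected_component (- J) z (f' (g' (p k) + h))"
    unfolding fg'(6) by (rule connected_component_sym)
  ultimately have "connected_component (- J) (f' (g' (p k) - h)) (f' (g' (p k) + h))"
    using sz by (meson connected_component_trans)
  \<comment> \<open>Points of \<open>m\<close> just before and just after \<open>p k\<close> are now
    joined off \<open>J\<close>, hence lie on the same side of \<open>l\<close>, although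
    \<open>m\<close> crosses \<open>l\<close> between them.\<close>
  then have "connected_component (- l) (f' (g' (p k) - h)) (f' (g' (p k) + h))"
    using U(3) d(2) h by simp
  with crossing_separates[OF fg'(1) cross, of "g' (p k) - h" "g' (p k) + h"] h show False by simp
qed

section \<open>Comparing the exits of two viewers\<close>

lemma first_exit_point_unique:
  assumes "a < n" "k < n" "a \<noteq> k"
    and y: "first_exit_point n p LL a k y" "y \<noteq> p k"
    and z: "first_exit_point n p LL a k z" "z \<noteq> p k"
  shows "y = z"
proof -
  let ?l = "line a k"
  have y': "y \<in> ray_away ?l (p k) (p a)" "y \<in> ?l" and z': "z \<in> ray_away ?l (p k) (p a)" "z \<in> ?l"
    using y z by (auto simp: first_exit_point_def Let_def ray_away_def)
  have yz: "y \<in> subsegment ?l (p k) z" "z \<in> subsegment ?l (p k) y"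
    using y(1) z(1) by (auto simp: first_exit_point_def Let_def)
  obtain f g where fg: "homeomorphism (UNIV :: real set) ?l f g" "g (p k) < g y" "f (g y) = y"
    "subsegment ?l (p k) y = f ` {g (p k)..g y}"
    using ray_parametrization[OF assms(1-3) y'(1) y(2)] by metis
  have gf: "g (f t) = t" for t using homeomorphism_apply1[OF fg(1)] by auto
  \<comment> \<open>By maximality each exit point lies on the initial piece ending at the other,
    which gives both inequalities between the parameters.\<close>
  have "z \<in> f ` {g (p k)..g y}" using fg yz by auto
  then have "g (p k) \<le> g z" "g z \<le> g y" using gf by auto
  moreover have "y \<in> f ` {g (p k)..g z}"
    using yz(1) subsegment_eq[OF fg(1) line_props(3)[OF assms(1-3)] z'(2)] \<open>g (p k) \<le> g z\<close>
    by (simp add: closed_segment_eq_real_ivl)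
  then have "g y \<le> g z" using gf by auto
  ultimately have "g y = g z" by simp
  then show ?thesis
    using fg(3) homeomorphism_apply2[OF fg(1) z'(2)] by metis
qed

text \<open>Chains without a common edge may still share vertices. A shared point is a vertex, but
  the only vertices on the line are \<open>p s\<close> and \<open>p k\<close>, and the exit point is
  neither: it lies strictly beyond \<open>p k\<close>, away from \<open>p s\<close>.\<close>

lemma exit_off_disjoint_chain:
  assumes "s < n" "k < n" "s \<noteq> k" "u < n" "v < n" "u' < n" "v' < n"
    and z: "first_exit_point n p LL s k z" "z \<in> chain u' v'"
    and k: "k \<notin> bd_verts n u' v'"
    and disj: "bd_edges n u v \<inter> bd_edges n u' v' = {}"
  shows "z \<notin> chain u v" "z \<noteq> p k" "z \<in> boundary"
proof -
  show zk: "z \<noteq> p k" using vertex_in_chain assms by metis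
  show "z \<in> boundary" using z assms by (auto simp: bdry_def mem_bd_edges)
  have zr: "z \<in> ray_away (line s k) (p k) (p s)" "z \<in> line s k"
    using z by (auto simp: first_exit_point_def Let_def ray_away_def)
  have zs: "z \<noteq> p s"
    using ray_parametrization[OF assms(1-3) zr(1) zk] by (metis less_asym)
  show "z \<notin> chain u v"
  proof
    assume "z \<in> chain u v"
    then obtain m m' where "m \<in> bd_edges n u v" "z \<in> side m" "m' \<in> bd_edges n u' v'" "z \<in> side m'"
      using z by blast
    moreover from this have "m < n" "m' < n" "m \<noteq> m'"
      using assms by (auto simp: mem_bd_edges)
    ultimately obtain w where "w < n" "z = p w" using sides_meet_at_vertex by metis
    then show False using vertex_on_line[OF assms(1-3)] zr(2) zk zs by blast
  qed
qed

lemma no_common_designated_blocker: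
  assumes vis: "visible_pair n p LL a k" "visible_pair n p LL s k"
    and uv: "u < n" "v < n" "u \<noteq> v" "a = u \<or> a = v" "k \<notin> bd_verts n u v"
    and uv': "u' < n" "v' < n" "u' \<noteq> v'" "s = u' \<or> s = v'" "k \<notin> bd_verts n u' v'"
    and disj: "bd_edges n u v \<inter> bd_edges n u' v' = {}"
      "s \<in> bd_verts n u v \<Longrightarrow> a \<in> bd_verts n u' v' \<Longrightarrow> a = s"
    and ex: "exits_through n p LL a k (bd_edges n u v)"
      "exits_through n p LL s k (bd_edges n u' v')"
  shows False
proof -
  have idx: "a < n" "k < n" "a \<noteq> k" "s < n" "s \<noteq> k"
    using vis by (auto simp: visible_pair_def)
  obtain y z where y: "first_exit_point n p LL a k y" "y \<in> chain u v"
    and z: "first_exit_point n p LL s k z" "z \<in> chain u' v'"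
    using ex unfolding exits_through_def by blast
  note zz = exit_off_disjoint_chain[OF idx(4,2,5) uv(1,2) uv'(1,2) z uv'(5) disj(1)]
  have "bd_edges n u' v' \<inter> bd_edges n u v = {}" using disj(1) by blast
  note yy = exit_off_disjoint_chain[OF idx(1-3) uv'(1,2) uv(1,2) y uv(5) this]
  show False
  proof (cases "a = s")
    case True
    then have "y = z"
      using first_exit_point_unique idx y(1) z(1) yy zz by blast
    then show False using yy z by blast
  next
    case False
    \<comment> \<open>Alternation needs the other viewer off the chain that closes up the chord; the
      roles of the viewers are chosen accordingly.\<close>
    then have "s \<notin> bd_verts n u v \<or> a \<notin> bd_verts n u' v'" using disj(2) by blast
    then show False
    proof
      assume "s \<notin> bd_verts n u v"
      from chords_through_vertex_alternate[OF vis False y(1) z(1) uv this y(2) zz(3,1,2)]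
      show False .
    next
      assume "a \<notin> bd_verts n u' v'"
      from chords_through_vertex_alternate[OF vis(2,1) False[symmetric] z(1) y(1) uv' this z(2) yy(3,1,2)]
      show False .
    qed
  qed
qed

text \<open>Merges the two cases of the definition: \<open>(u, v)\<close> is the pair oriented so
  that its chain carries the exit. The blocker is off this chain because the two walks between
  \<open>p i\<close> and \<open>p j\<close> share only their ends.\<close>

lemma designated_blockerE:
  assumes "designated_blocker n p LL (i, j) k"
  obtains u v where "{u, v} = {i, j}" "u < n" "v < n" "u \<noteq> v" "k < n" "k \<noteq> u" "k \<noteq> v"
    "k \<notin> bd_verts n u v"
    "visible_pair n p LL i k" "exits_through n p LL i k (bd_edges n u v)"
proof -
  have b: "i < n" "j < n" "i \<noteq> j" "k < n" "k \<noteq> i" "k \<noteq> j" "visible_pair n p LL i k"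
    "k \<in> bd_verts n i j \<and> exits_through n p LL i k (bd_edges n j i) \<or>
     k \<in> bd_verts n j i \<and> exits_through n p LL i k (bd_edges n i j)"
    using assms by (auto simp: designated_blocker_def invisible_pair_def)
  have opp: "k \<notin> bd_verts n y x" if "k \<in> bd_verts n x y" "{x, y} = {i, j}" for x y
    using that b by (auto simp: doubleton_eq_iff mem_bd_verts split: if_splits)
  from b(8) show thesis
  proof
    assume "k \<in> bd_verts n i j \<and> exits_through n p LL i k (bd_edges n j i)"
    then show thesis using opp[of i j] b by (intro that[of j i]) auto
  next
    assume "k \<in> bd_verts n j i \<and> exits_through n p LL i k (bd_edges n i j)"
    then show thesis using opp[of j i] b by (intro that[of i j]) auto
  qed
qed

end

theorem mainTheorem6:
  fixes n :: nat and p :: "nat \<Rightarrow> complex" and LL :: "complex set set"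
    and k :: nat and A B :: "nat \<times> nat"
  assumes "pseudo_polygon n p LL"
    and "separable n p LL k A B"
  shows "(designated_blocker n p LL A k \<longrightarrow> \<not> designated_blocker n p LL B k) \<and>
         (designated_blocker n p LL B k \<longrightarrow> \<not> designated_blocker n p LL A k)"
proof -
  interpret ppolygon n p LL using assms(1) by unfold_locales
  have False if dA: "designated_blocker n p LL A k" and dB: "designated_blocker n p LL B k"
  proof -
    obtain i j s t where ij: "A = (i, j) \<or> A = (j, i)" and B: "B = (s, t)"
      and pos: "i \<in> bd_verts n j k" "s \<in> bd_verts n k j" "t \<in> bd_verts n k j"
      using assms(2) unfolding separable_def by blast
    obtain a b where A: "A = (a, b)" and ab: "{a, b} = {i, j}" using ij by auto
    obtain u v where uv: "{u, v} = {a, b}" "u < n" "v < n" "u \<noteq> v" "k < n" "k \<noteq> u" "k \<noteq> v"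
      "k \<notin> bd_verts n u v"
      "visible_pair n p LL a k" "exits_through n p LL a k (bd_edges n u v)"
      using dA unfolding A by (rule designated_blockerE)
    obtain u' v' where uv': "{u', v'} = {s, t}" "u' < n" "v' < n" "u' \<noteq> v'" "k < n" "k \<noteq> u'" "k \<noteq> v'"
      "k \<notin> bd_verts n u' v'"
      "visible_pair n p LL s k" "exits_through n p LL s k (bd_edges n u' v')"
      using dB unfolding B by (rule designated_blockerE)
    have idx: "i < n" "j < n" "s < n" "t < n" "k \<noteq> i" "k \<noteq> j"
      using ab uv uv' by (auto simp: doubleton_eq_iff)
    \<comment> \<open>As \<open>p i\<close> comes before \<open>p k\<close> on the walk from
      \<open>p j\<close>, the walk from \<open>p i\<close> to \<open>p j\<close> passes
      \<open>p k\<close>; only the one from \<open>p j\<close> to \<open>p i\<close> avoids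
      it.\<close>
    have chain_A: "u = j" "v = i"
      using pos(1) uv ab idx by (auto simp: doubleton_eq_iff mem_bd_verts split: if_splits)
    have chain_B: "u' \<in> bd_verts n k j" "v' \<in> bd_verts n k j"
      using pos uv'(1) by (auto simp: doubleton_eq_iff)
    \<comment> \<open>A walk with both ends in \<open>\<partial>(p k, p j)\<close> that avoids
      \<open>p k\<close> stays in there, and \<open>\<partial>(p j, p i)\<close> meets that part of
      the boundary only in \<open>p j\<close>.\<close>
    have "bd_edges n j i \<inter> bd_edges n u' v' = {}"
      using pos(1) chain_B uv(5-8) uv'(2-8) idx unfolding chain_A
      by (auto simp: mem_bd_verts mem_bd_edges split: if_splits)
    moreover have "w = j" if "w \<in> bd_verts n j i" "w \<in> bd_verts n u' v'" for w
      using that pos(1) chain_B uv(5-8) uv'(2-8) idx unfolding chain_A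
      by (auto simp: mem_bd_verts split: if_splits)
    moreover have "a = u \<or> a = v" "s = u' \<or> s = v'"
      using uv(1) uv'(1) by (auto simp: doubleton_eq_iff)
    \<comment> \<open>Each viewer lies on its own chain. If each also lay on the chain of the other,
      both would be \<open>p j\<close>, so they would coincide.\<close>
    moreover have "a \<in> bd_verts n j i" "s \<in> bd_verts n u' v'"
      using calculation(3,4) uv'(2,3) idx unfolding chain_A
      by (auto simp: mem_bd_verts split: if_splits)
    ultimately show False
      using no_common_designated_blocker[OF uv(9) uv'(9) uv(2-4) _ uv(8) uv'(2-4) _ uv'(8) _ _ uv(10) uv'(10)]
      unfolding chain_A by blast
  qed
  then show ?thesis by blast
qed

end
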